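(* Let $G$ be a graph with $n\ge 4$ vertices whose maximum degree satisfies $\Delta(G)\ge n-2$. Then $G$ is antimagic.
   Context: All graphs are finite, undirected and simple; $\Delta(G)$ denotes the maximum degree of $G$. An antimagic labeling of a graph with $m$ edges and $n$ vertices is a bijection from the set of edges to the integers $\{1,\ldots,m\}$ such that all $n$ vertex sums are pairwise distinct, where a vertex sum is the sum of the labels of all edges incident with that vertex (an isolated vertex has vertex sum $0$). A graph is called antimagic if it has an antimagic labeling. *)

theory Defs
  imports Main
begin

text \<open>A finite undirected simple graph with vertex set \<open>V\<close>; edges are two-element sets of vertices,
  which excludes loops and multiple edges. Isolated vertices are allowed.\<close>

definition simple_graph :: "'a set \<Rightarrow> 'a set set \<Rightarrow> bool" where
  "simple_graph V E \<longleftrightarrow> finite V \<and> (\<forall>e\<in>E. e \<subseteq> V \<and> card e = 2)"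

definition degree :: "'a set set \<Rightarrow> 'a \<Rightarrow> nat" where
  "degree E v = card {e \<in> E. v \<in> e}"

text \<open>Meaningful for nonempty finite \<open>V\<close> only.\<close>

definition max_degree :: "'a set \<Rightarrow> 'a set set \<Rightarrow> nat" where
  "max_degree V E = Max (degree E ` V)"

definition vertex_sum :: "'a set set \<Rightarrow> ('a set \<Rightarrow> nat) \<Rightarrow> 'a \<Rightarrow> nat" where
  "vertex_sum E f v = (\<Sum>e\<in>{e \<in> E. v \<in> e}. f e)"

definition antimagic_labeling :: "'a set \<Rightarrow> 'a set set \<Rightarrow> ('a set \<Rightarrow> nat) \<Rightarrow> bool" where
  "antimagic_labeling V E f \<longleftrightarrow>
     bij_betw f E {1..card E} \<and> inj_on (vertex_sum E f) V"

definition antimagic :: "'a set \<Rightarrow> 'a set set \<Rightarrow> bool" where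
  "antimagic V E \<longleftrightarrow> (\<exists>f. antimagic_labeling V E f)"

end

theory Submission
  imports Defs
begin

text \<open>Let \<open>v\<close> have maximum degree \<open>k\<close>, and suppose the \<open>a\<close> edges avoiding \<open>v\<close> carry the labels
  \<open>1, \<dots>, a\<close>. Giving the labels \<open>a + 1, \<dots>, a + k\<close> to the star of \<open>v\<close>, in the order of the partial sums
  at the other ends, separates all neighbours of \<open>v\<close>, and \<open>v\<close> has the largest sum. This settles the
  case \<open>k = n - 1\<close>. If \<open>k = n - 2\<close>, there is one non-neighbour \<open>u\<close>, say of degree \<open>d\<close>; its edges may
  take the labels \<open>1, \<dots>, d\<close>, so the same works when \<open>1 + \<dots> + d \<le> a\<close>.

  Otherwise fix an edge \<open>{u, x}\<close>, let the other edges avoiding \<open>v\<close> take \<open>1, \<dots>, a - 1\<close>, and distribute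
  \<open>a, \<dots>, a + k\<close> over the star and \<open>{u, x}\<close> in the order of the partial sums at the neighbours of \<open>v\<close>
  and at \<open>u\<close>. This separates all vertices but \<open>v\<close>, whose sum is again the largest when \<open>k \<ge> 4\<close>;
  for \<open>k = 2, 3\<close> the failure of \<open>1 + \<dots> + d \<le> a\<close> leaves few possibilities.\<close>

section \<open>Rankings\<close>

text \<open>The induction adds elements in order of nondecreasing \<open>key\<close>, so each new
  one can take the next free value.\<close>

lemma ex_ranking:
  fixes key :: "'a \<Rightarrow> nat"
  assumes "finite X"
  shows "\<exists>r. bij_betw r X {a..<a + card X} \<and> (\<forall>y\<in>X. \<forall>z\<in>X. key y < key z \<longrightarrow> r y < (r z :: nat))"
  using assms
proof (induction X rule: finite_ranking_induct[where f = key])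
  case empty
  then show ?case by (simp add: bij_betw_def)
next
  case (insert x S)
  show ?case
  proof (cases "x \<in> S")
    case True
    then show ?thesis using insert.IH by (simp add: insert_absorb)
  next
    case False
    from insert.IH obtain r where r: "bij_betw r S {a..<a + card S}"
      and mono: "\<forall>y\<in>S. \<forall>z\<in>S. key y < key z \<longrightarrow> r y < r z" by blast
    let ?r = "r(x := a + card S)"
    have "bij_betw ?r S {a..<a + card S}"
      using r False by (subst bij_betw_cong[where g = r]) auto
    then have "bij_betw ?r (insert x S) (insert (a + card S) {a..<a + card S})"
      using False notIn_Un_bij_betw[of x S ?r "{a..<a + card S}"] by simp
    moreover have "insert (a + card S) {a..<a + card S} = {a..<a + card (insert x S)}"
      using False \<open>finite S\<close> by auto
    moreover have "r y < a + card S" if "y \<in> S" for y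
      using r that by (auto simp: bij_betw_def)
    then have "\<forall>y\<in>insert x S. \<forall>z\<in>insert x S. key y < key z \<longrightarrow> ?r y < ?r z"
      using mono insert.hyps(2) False by (auto simp: not_less[symmetric])
    ultimately show ?thesis by (intro exI[of _ ?r] conjI) (simp_all only:)
  qed
qed

text \<open>Where \<open>w\<close> differs, adding \<open>r\<close> only widens the gap; where
  \<open>w\<close> ties, the injective \<open>r\<close> decides.\<close>

lemma monotone_ranking_inj:
  fixes w r :: "'a \<Rightarrow> nat"
  assumes "inj_on r X" and "\<And>y z. y \<in> X \<Longrightarrow> z \<in> X \<Longrightarrow> w y < w z \<Longrightarrow> r y < r z"
  shows "inj_on (\<lambda>y. w y + r y) X"
proof (rule inj_onI)
  fix y z assume yz: "y \<in> X" "z \<in> X" "w y + r y = w z + r z"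
  then have "w y = w z"
    using assms(2)[of y z] assms(2)[of z y] by (cases "w y" "w z" rule: linorder_cases) auto
  then show "y = z" using yz assms(1) by (auto dest: inj_onD)
qed

text \<open>The rank of \<open>u\<close> is also added at \<open>x\<close>, so the weight to be ranked at \<open>x\<close> depends on the
  ranking. It does so harmlessly: if \<open>c\<close> elements other than \<open>x\<close> lie below \<open>u\<close>, the rank of \<open>u\<close> is
  \<open>a + c\<close> or \<open>a + c + 1\<close> according to whether \<open>x\<close> comes after or before \<open>u\<close>, and one of these two
  choices is always consistent.\<close>

lemma ex_ranking_with_transfer:
  fixes w :: "'a \<Rightarrow> nat"
  assumes X: "finite X" "u \<in> X" "x \<in> X" "u \<noteq> x"
  shows "\<exists>r. bij_betw r X {a..<a + card X}
    \<and> inj_on (\<lambda>y. w y + (if y = x then r u else 0) + r y) X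
    \<and> (Suc (r u) < a + card X \<or> r u \<le> w u)"
proof -
  define C where "C = {y \<in> X - {u, x}. w y < w u}"
  define c where "c = card C"
  have finC: "finite C" using X(1) by (simp add: C_def)
  \<comment> \<open>Placing \<open>x\<close> after \<open>u\<close> gives \<open>u\<close> rank
    \<open>a + c\<close> and so requires \<open>w u \<le> w x + a + c\<close>. If this fails,
    \<open>w x + a + c + 1 \<le> w u\<close>, which allows \<open>x\<close> to precede
    \<open>u\<close>.\<close>
  define late where "late \<longleftrightarrow> w u \<le> w x + a + c"
  define t where "t = (if late then a + c else a + c + 1)"
  define W where "W y = w y + (if y = x then t else 0)" for y
  \<comment> \<open>The factor 3 leaves room to break ties between \<open>u\<close> and the others as required.\<close>
  define key where
    "key y = 3 * W y + (if y = u then 1 else if y = x \<and> \<not> late then 0 else 2)" for y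
  obtain r where r: "bij_betw r X {a..<a + card X}"
    and mono: "\<And>y z. y \<in> X \<Longrightarrow> z \<in> X \<Longrightarrow> key y < key z \<Longrightarrow> r y < r z"
    using ex_ranking[OF X(1), of a key] by blast
  have keyW: "key y < key z" if "W y < W z" for y z
    using that by (auto simp: key_def)
  have xu: "key x < key u \<longleftrightarrow> \<not> late" "key u < key x \<longleftrightarrow> late"
    using X(4) by (auto simp: key_def W_def t_def late_def)
  have yu: "key y < key u \<longleftrightarrow> w y < w u" "key u < key y \<longleftrightarrow> w u \<le> w y" if "y \<noteq> u" "y \<noteq> x" for y
    using that X(4) by (auto simp: key_def W_def)
  have ne: "key y \<noteq> key u" if "y \<noteq> u" for y
    using that xu yu[of y] by (cases "y = x") auto
  \<comment> \<open>As no other key equals that of \<open>u\<close>, the rank of \<open>u\<close> is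
    \<open>a\<close> plus the number of smaller keys.\<close>
  have below: "{y \<in> X. r y < r u} = {y \<in> X. key y < key u}"
  proof (intro Collect_cong conj_cong refl iffI)
    fix y assume y: "y \<in> X" "r y < r u"
    then have "\<not> key u < key y" using mono[of u y] X(2) by auto
    then show "key y < key u" using ne[of y] y by (cases "y = u") auto
  qed (use mono X(2) in auto)
  have "r ` {y \<in> X. r y < r u} = {a..<r u}"
  proof (intro set_eqI iffI)
    fix i assume i: "i \<in> {a..<r u}"
    have "r u < a + card X" using r X(2) by (auto simp: bij_betw_def)
    then have "i \<in> r ` X" using r i by (auto simp: bij_betw_def)
    then show "i \<in> r ` {y \<in> X. r y < r u}" using i by auto
  qed (use r in \<open>auto simp: bij_betw_def\<close>)
  moreover have "inj_on r {y \<in> X. r y < r u}"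
    using r by (auto simp: bij_betw_def intro: inj_on_subset)
  ultimately have "card {y \<in> X. r y < r u} = r u - a"
    using card_image by fastforce
  moreover have "{y \<in> X. key y < key u} = (if late then C else insert x C)"
  proof (rule set_eqI)
    fix y show "y \<in> {y \<in> X. key y < key u} \<longleftrightarrow> y \<in> (if late then C else insert x C)"
      using X xu yu[of y] by (cases "y = u"; cases "y = x") (auto simp: C_def)
  qed
  moreover have "x \<notin> C" by (simp add: C_def)
  moreover have "a \<le> r u" using r X(2) by (auto simp: bij_betw_def)
  ultimately have ru: "r u = t"
    using below finC by (auto simp: t_def c_def split: if_splits)
  have "inj_on (\<lambda>y. W y + r y) X"
    using r by (intro monotone_ranking_inj) (auto simp: bij_betw_def intro: mono keyW)
  \<comment> \<open>If \<open>late\<close>, \<open>x\<close> outranks \<open>u\<close>, so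
    \<open>u\<close> is not last; otherwise \<open>t = a + c + 1\<close> is at most
    \<open>w u\<close>.\<close>
  moreover have "Suc (r u) < a + card X \<or> r u \<le> w u"
  proof (cases late)
    case True
    have "r x < a + card X" using r X(3) by (auto simp: bij_betw_def)
    then show ?thesis using mono[of u x] X xu True by auto
  next
    case False
    then show ?thesis using ru by (auto simp: t_def late_def)
  qed
  ultimately show ?thesis using r unfolding W_def ru[symmetric] by blast
qed

text \<open>Giving the smallest labels to the edges at one vertex makes its partial sum a triangular
  number.\<close>

lemma ex_bij_betw_initial:
  assumes "finite F" "W \<subseteq> F"
  shows "\<exists>g. bij_betw g F {1..card F} \<and> bij_betw g W {1..card W}"
proof -
  have fin: "finite W" "finite (F - W)" using assms finite_subset by auto
  have le: "card W \<le> card F" using assms card_mono by blast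
  have "card (F - W) = card {card W + 1..card F}"
    using assms fin by (simp add: card_Diff_subset)
  then obtain g2 where g2: "bij_betw g2 (F - W) {card W + 1..card F}"
    using fin finite_same_card_bij by blast
  obtain g1 where g1: "bij_betw g1 W {1..card W}"
    using fin finite_same_card_bij[of W "{1..card W}"] by auto
  let ?g = "\<lambda>e. if e \<in> W then g1 e else g2 e"
  have 1: "bij_betw ?g W {1..card W}"
    using g1 by (subst bij_betw_cong[where g = g1]) auto
  have "bij_betw ?g (F - W) {card W + 1..card F}"
    using g2 by (subst bij_betw_cong[where g = g2]) auto
  then have "bij_betw ?g (W \<union> (F - W)) ({1..card W} \<union> {card W + 1..card F})"
    using 1 by (intro bij_betw_combine) auto
  moreover have "W \<union> (F - W) = F" using assms(2) by blast
  moreover have "{1..card W} \<union> {card W + 1..card F} = {1..card F}" using le by auto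
  ultimately show ?thesis using 1 by auto
qed

lemma sum_interval_from:
  fixes a k :: nat
  shows "2 * \<Sum>{a..<a + Suc k} = (k + 1) * (2 * a + k)"
proof (induction k)
  case (Suc k)
  have "\<Sum>{a..<a + Suc (Suc k)} = \<Sum>{a..<a + Suc k} + (a + Suc k)"
    by (simp add: atLeastLessThanSuc)
  then show ?case using Suc by (simp add: algebra_simps)
qed simp

section \<open>Labelling the star of a vertex\<close>

lemma vertex_sum_le:
  assumes "finite E" "\<And>e. e \<in> E \<Longrightarrow> f e \<le> b"
  shows "vertex_sum E f v \<le> degree E v * b"
  using sum_bounded_above[of "{e \<in> E. v \<in> e}" f b] assms by (simp add: vertex_sum_def degree_def)

section \<open>Splitting the edges into the star of a vertex and the rest\<close>

definition neighbours :: "'a set set \<Rightarrow> 'a \<Rightarrow> 'a set" where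
  "neighbours E v = {y. {v, y} \<in> E}"

definition avoiding :: "'a set set \<Rightarrow> 'a \<Rightarrow> 'a set set" where
  "avoiding E v = {e \<in> E. v \<notin> e}"

context
  fixes V :: "'a set" and E :: "'a set set"
  assumes graph: "simple_graph V E"
begin

lemma finite_edges: "finite E"
  using graph by (auto simp: simple_graph_def intro: finite_subset[of E "Pow V"])

lemma neighbour_ne: "y \<in> neighbours E v \<Longrightarrow> y \<noteq> v"
  using graph by (auto simp: simple_graph_def neighbours_def)

lemma neighbours_subset: "neighbours E v \<subseteq> V"
  using graph by (auto simp: simple_graph_def neighbours_def)

lemma finite_neighbours: "finite (neighbours E v)"
  using graph neighbours_subset by (auto simp: simple_graph_def intro: finite_subset)

lemma edge_at:
  assumes "e \<in> E" "v \<in> e"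
  shows "\<exists>y\<in>neighbours E v. e = {v, y}"
proof -
  obtain p q where "e = {p, q}" using graph assms(1) by (auto simp: simple_graph_def card_2_iff)
  then have "\<exists>y. e = {v, y}" using assms(2) by (auto simp: doubleton_eq_iff)
  then show ?thesis using assms(1) by (auto simp: neighbours_def)
qed

lemma star_eq: "{e \<in> E. v \<in> e} = (\<lambda>y. {v, y}) ` neighbours E v"
  using edge_at by (auto simp: neighbours_def)

lemma inj_star: "inj_on (\<lambda>y. {v, y}) (neighbours E v)"
  by (auto simp: inj_on_def doubleton_eq_iff)

lemma degree_eq_card_neighbours: "degree E v = card (neighbours E v)"
  by (simp add: degree_def star_eq card_image inj_star)

lemma edges_eq: "E = avoiding E v \<union> (\<lambda>y. {v, y}) ` neighbours E v"
  using star_eq by (auto simp: avoiding_def)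

lemma edges_at_neighbour:
  assumes "y \<in> neighbours E v"
  shows "{e \<in> E. y \<in> e} = insert {v, y} {e \<in> avoiding E v. y \<in> e}"
  using assms edge_at neighbour_ne by (auto simp: avoiding_def neighbours_def)

lemma edges_at_non_neighbour:
  assumes "y \<noteq> v" "y \<notin> neighbours E v"
  shows "{e \<in> E. y \<in> e} = {e \<in> avoiding E v. y \<in> e}"
  using assms edge_at by (auto simp: avoiding_def)

lemma finite_avoiding: "finite (avoiding E v)"
  using finite_edges by (simp add: avoiding_def)

lemma card_edges: "card E = card (avoiding E v) + card (neighbours E v)"
proof -
  have "card E = card (avoiding E v) + card ((\<lambda>y. {v, y}) ` neighbours E v)"
    by (subst edges_eq, rule card_Un_disjoint)
      (auto simp: finite_avoiding finite_neighbours, auto simp: avoiding_def)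
  then show ?thesis by (simp add: card_image inj_star)
qed

lemma degree_neighbour:
  assumes "y \<in> neighbours E v"
  shows "degree E y = Suc (degree (avoiding E v) y)"
proof -
  have "{v, y} \<notin> avoiding E v" by (simp add: avoiding_def)
  then show ?thesis
    unfolding degree_def edges_at_neighbour[OF assms] by (simp add: finite_avoiding)
qed

lemma degree_non_neighbour:
  "y \<noteq> v \<Longrightarrow> y \<notin> neighbours E v \<Longrightarrow> degree E y = degree (avoiding E v) y"
  unfolding degree_def by (subst edges_at_non_neighbour) auto

text \<open>A star edge is determined by its other end, so labels on the star amount to a function
  \<open>r\<close> on the neighbours.\<close>

lemma ex_star_extension:
  assumes g: "bij_betw g (avoiding E v) A" and r: "bij_betw r (neighbours E v) B"
    and disj: "A \<inter> B = {}"
  shows "\<exists>f. bij_betw f E (A \<union> B)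
    \<and> (\<forall>y\<in>neighbours E v. vertex_sum E f y = vertex_sum (avoiding E v) g y + r y)
    \<and> (\<forall>y. y \<noteq> v \<longrightarrow> y \<notin> neighbours E v \<longrightarrow> vertex_sum E f y = vertex_sum (avoiding E v) g y)
    \<and> vertex_sum E f v = sum r (neighbours E v)"
proof -
  define f where "f e = (if v \<in> e then r (the_elem (e - {v})) else g e)" for e
  have fstar: "f {v, y} = r y" if "y \<in> neighbours E v" for y
    using neighbour_ne[OF that] by (simp add: f_def insert_Diff_if)
  have fav: "f e = g e" if "e \<in> avoiding E v" for e
    using that by (simp add: f_def avoiding_def)
  have sumav: "sum f {e \<in> avoiding E v. y \<in> e} = vertex_sum (avoiding E v) g y" for y
    unfolding vertex_sum_def by (intro sum.cong) (auto simp: fav)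
  have "bij_betw f (avoiding E v) A"
    using g by (subst bij_betw_cong[where g = g]) (auto simp: fav)
  moreover have "bij_betw f ((\<lambda>y. {v, y}) ` neighbours E v) B"
  proof -
    have "bij_betw (f \<circ> (\<lambda>y. {v, y})) (neighbours E v) B"
      using r by (subst bij_betw_cong[where g = r]) (auto simp: fstar)
    then show ?thesis
      using bij_betw_comp_iff[OF inj_on_imp_bij_betw[OF inj_star]] by blast
  qed
  ultimately have "bij_betw f E (A \<union> B)"
    using bij_betw_combine disj edges_eq by metis
  moreover have "vertex_sum E f y = vertex_sum (avoiding E v) g y + r y"
    if "y \<in> neighbours E v" for y
  proof -
    have "{v, y} \<notin> avoiding E v" by (simp add: avoiding_def)
    then have "vertex_sum E f y = f {v, y} + sum f {e \<in> avoiding E v. y \<in> e}"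
      unfolding vertex_sum_def edges_at_neighbour[OF that] by (simp add: finite_avoiding)
    then show ?thesis by (simp add: fstar that sumav)
  qed
  moreover have "vertex_sum E f y = vertex_sum (avoiding E v) g y"
    if "y \<noteq> v" "y \<notin> neighbours E v" for y
    using sumav[of y] by (simp add: vertex_sum_def edges_at_non_neighbour[OF that])
  moreover have "vertex_sum E f v = sum r (neighbours E v)"
    by (simp add: vertex_sum_def star_eq sum.reindex inj_star fstar)
  ultimately show ?thesis by blast
qed

text \<open>If the star of \<open>v\<close> receives the largest labels, \<open>v\<close> automatically has the largest sum, and
  the neighbours of \<open>v\<close> can be separated by ranking them.\<close>

lemma antimagic_star_on_top:
  assumes v: "v \<in> V" and k: "card (neighbours E v) \<ge> 2"
    and deg: "\<And>y. y \<in> V \<Longrightarrow> degree E y \<le> card (neighbours E v)"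
    and g: "bij_betw g (avoiding E v) {1..card (avoiding E v)}"
    and U: "V - {v} - neighbours E v \<subseteq> {u}"
    and u: "u \<in> V - {v} - neighbours E v \<Longrightarrow>
      vertex_sum (avoiding E v) g u \<le> card (avoiding E v)"
  shows "antimagic V E"
proof -
  let ?N = "neighbours E v" and ?E0 = "avoiding E v"
  let ?a = "card ?E0" and ?k = "card ?N"
  let ?w = "vertex_sum ?E0 g"
  obtain r where r: "bij_betw r ?N {Suc ?a..<Suc ?a + ?k}"
    and mono: "\<And>y z. y \<in> ?N \<Longrightarrow> z \<in> ?N \<Longrightarrow> ?w y < ?w z \<Longrightarrow> r y < r z"
    using ex_ranking[OF finite_neighbours[of v], of "Suc ?a" ?w] by blast
  have rge: "Suc ?a \<le> r y" if "y \<in> ?N" for y using r that by (auto simp: bij_betw_def)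
  have disj: "{1..?a} \<inter> {Suc ?a..<Suc ?a + ?k} = {}" by auto
  obtain f where f: "bij_betw f E ({1..?a} \<union> {Suc ?a..<Suc ?a + ?k})"
    and fN: "\<And>y. y \<in> ?N \<Longrightarrow> vertex_sum E f y = ?w y + r y"
    and fU: "\<And>y. y \<noteq> v \<Longrightarrow> y \<notin> ?N \<Longrightarrow> vertex_sum E f y = ?w y"
    and fv: "vertex_sum E f v = sum r ?N"
    using ex_star_extension[OF g r] disj by blast
  have "{1..?a} \<union> {Suc ?a..<Suc ?a + ?k} = {1..card E}"
    by (auto simp: card_edges[of v])
  then have bij: "bij_betw f E {1..card E}" using f by simp
  have "inj_on (\<lambda>y. ?w y + r y) ?N"
    using r by (intro monotone_ranking_inj) (auto simp: bij_betw_def intro: mono)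
  then have injN: "inj_on (vertex_sum E f) ?N"
    by (rule inj_on_cong[THEN iffD1, rotated]) (simp add: fN)
  \<comment> \<open>The edge \<open>{v, y}\<close> counts in both sums. Beyond it, \<open>y\<close>
    has at most \<open>?k - 1\<close> labels, none above \<open>?a\<close>, and \<open>v\<close> has
    \<open>?k - 1\<close> labels, all above \<open>?a\<close>.\<close>
  have vN: "vertex_sum E f y < vertex_sum E f v" if y: "y \<in> ?N" for y
  proof -
    have "?w y \<le> degree ?E0 y * ?a"
      using g by (intro vertex_sum_le finite_avoiding) (auto simp: bij_betw_def)
    also have "\<dots> \<le> (?k - 1) * ?a"
      using deg[of y] degree_neighbour[OF y] neighbours_subset[of v] y by (intro mult_right_mono) auto
    also have "\<dots> < (?k - 1) * Suc ?a" using k by simp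
    also have "(?k - 1) * Suc ?a \<le> sum r (?N - {y})"
      using sum_bounded_below[of "?N - {y}" "Suc ?a" r] rge y finite_neighbours by simp
    finally show ?thesis
      using y by (simp add: fN fv sum.remove[OF finite_neighbours y])
  qed
  have uN: "vertex_sum E f u < vertex_sum E f y" if "u \<in> V - {v} - ?N" "y \<in> ?N" for y
    using u[OF that(1)] rge[OF that(2)] fU[of u] fN[OF that(2)] that(1) by auto
  obtain z where z: "z \<in> ?N" using k by fastforce
  have uv: "vertex_sum E f u < vertex_sum E f v" if "u \<in> V - {v} - ?N"
    using uN[OF that z] vN[OF z] by linarith
  have "inj_on (vertex_sum E f) V"
  proof (rule inj_onI)
    fix y z assume "y \<in> V" "z \<in> V" and eq: "vertex_sum E f y = vertex_sum E f z"
    moreover have "y \<in> V \<Longrightarrow> y = v \<or> y \<in> ?N \<or> (y = u \<and> u \<in> V - {v} - ?N)" for y using U by blast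
    ultimately consider "y = z" | "y = v" "z \<in> ?N" | "z = v" "y \<in> ?N" | "y \<in> ?N" "z \<in> ?N"
      | "u \<in> V - {v} - ?N" "y = u" "z = v \<or> z \<in> ?N" | "u \<in> V - {v} - ?N" "z = u" "y = v \<or> y \<in> ?N"
      by blast
    then show "y = z"
      using eq vN[of y] vN[of z] uN[of y] uN[of z] uv injN by cases (auto dest: inj_onD)
  qed
  then show ?thesis using bij by (auto simp: antimagic_def antimagic_labeling_def)
qed

text \<open>One edge \<open>{u, x}\<close> joins the star of \<open>v\<close> in receiving the largest labels. Then \<open>u\<close> is ranked
  together with the neighbours of \<open>v\<close>, with \<open>{u, x}\<close> playing the role of its star edge.\<close>

lemma antimagic_star_and_edge_on_top:
  assumes v: "v \<in> V" and k: "card (neighbours E v) \<ge> 2"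
    and deg: "\<And>y. y \<in> V \<Longrightarrow> degree E y \<le> card (neighbours E v)"
    and u: "V - {v} - neighbours E v = {u}"
    and big: "\<Sum>{1..degree E u} > card (avoiding E v)"
  shows "antimagic V E"
proof -
  let ?N = "neighbours E v" and ?E0 = "avoiding E v"
  define a where "a = card ?E0"
  define k where "k = card ?N"
  define d where "d = degree E u"
  have uV: "u \<in> V" "u \<noteq> v" "u \<notin> ?N" using u by auto
  have k2: "k \<ge> 2" using k by (simp add: k_def)
  have d0: "degree ?E0 u = d"
    using degree_non_neighbour[of u v] uV by (simp add: d_def)
  have dk: "d \<le> k" using deg uV by (simp add: d_def k_def)
  have da: "d \<le> a"
    using card_mono[OF finite_avoiding, of "{e \<in> ?E0. u \<in> e}" v] d0
    by (auto simp: degree_def a_def)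
  have abig: "2 * a < d * (d + 1)"
    using big double_gauss_sum_from_Suc_0[of d, where 'a = nat]
    by (simp add: a_def d_def[symmetric])
  \<comment> \<open>For \<open>d \<le> 1\<close> the sum up to \<open>d\<close> is \<open>d\<close>
    itself, which is at most \<open>a\<close>.\<close>
  have d2: "d \<ge> 2"
  proof (rule ccontr)
    assume "\<not> d \<ge> 2"
    then have "d = 0 \<or> d = 1" by auto
    then show False using abig da by auto
  qed
  have a2: "a \<ge> 2" using d2 da by simp

  have "{e \<in> ?E0. u \<in> e} \<noteq> {}" using d0 d2 unfolding degree_def by (metis card.empty not_numeral_le_zero)
  then obtain e where e: "e \<in> E" "v \<notin> e" "u \<in> e" by (auto simp: avoiding_def)
  then obtain x where x: "e = {u, x}" "x \<in> neighbours E u" using edge_at by blast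
  have xN: "x \<in> ?N" using x e neighbours_subset[of u] neighbour_ne[of x u] u by blast
  have ux: "u \<noteq> x" using xN uV by auto
  have e0: "{u, x} \<in> ?E0" using e x by (simp add: avoiding_def)
  define F where "F = ?E0 - {{u, x}}"
  have finF: "finite F" by (simp add: F_def finite_avoiding)
  have E0: "?E0 = insert {u, x} F" "{u, x} \<notin> F" using e0 by (auto simp: F_def)
  have cardF: "card F = a - 1" using e0 by (simp add: F_def a_def finite_avoiding)
  \<comment> \<open>The other edges at \<open>x\<close> get the smallest labels: \<open>x\<close>
    also receives the large label of \<open>{u, x}\<close>, and for \<open>k = 3\<close> its
    remaining sum must be at most 1.\<close>
  define W where "W = {e \<in> F. x \<in> e}"
  obtain g0 where g0: "bij_betw g0 F {1..a - 1}" "bij_betw g0 W {1..card W}"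
    using ex_bij_betw_initial[OF finF, of W] cardF by (auto simp: W_def)
  let ?w = "vertex_sum F g0"
  have degF: "degree ?E0 y = degree F y + (if y = u \<or> y = x then 1 else 0)" for y
  proof -
    have "{e \<in> ?E0. y \<in> e} = (if y = u \<or> y = x then insert {u, x} {e \<in> F. y \<in> e} else {e \<in> F. y \<in> e})"
      using E0 by auto
    then show ?thesis using E0(2) finF by (simp add: degree_def)
  qed
  have wle: "?w y \<le> degree F y * (a - 1)" for y
    using g0(1) by (intro vertex_sum_le finF) (auto simp: bij_betw_def)
  have degN: "degree ?E0 y \<le> k - 1" if "y \<in> ?N" for y
    using deg[of y] degree_neighbour[OF that] neighbours_subset[of v] that by (auto simp: k_def)
  have wu: "?w u \<le> (d - 1) * (a - 1)" using wle[of u] degF[of u] d0 by simp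
  have cardW: "card W \<le> k - 2"
    using degN[OF xN] degF[of x] by (simp add: W_def degree_def)
  have wxW: "?w x = \<Sum>{1..card W}"
    using sum.reindex_bij_betw[OF g0(2), of id] by (simp add: vertex_sum_def W_def)
  have wx: "?w x \<le> (k - 2) * (a - 1)"
    using wle[of x] mult_le_mono1[OF cardW, of "a - 1"] unfolding W_def degree_def by (rule le_trans)
  \<comment> \<open>All edges avoiding \<open>v\<close> then meet \<open>u\<close>, so
    \<open>{u, x}\<close> is the only one at \<open>x\<close>.\<close>
  have wx0: "?w x = 0" if "a = d"
  proof -
    have "{e \<in> ?E0. u \<in> e} = ?E0"
      using that d0 by (intro card_subset_eq finite_avoiding) (auto simp: degree_def a_def)
    then have "u \<in> e" if "e \<in> W" for e using that by (auto simp: W_def F_def)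
    moreover have "e = {u, x}" if "e \<in> W" "u \<in> e" for e
      using that ux edge_at[of e u] by (auto simp: W_def F_def avoiding_def)
    ultimately have "W = {}" using E0(2) by (auto simp: W_def)
    then show ?thesis using wxW by simp
  qed

  let ?X = "insert u ?N"
  have cardX: "card ?X = Suc k" using uV by (simp add: k_def finite_neighbours)
  obtain r where r: "bij_betw r ?X {a..<a + Suc k}"
    and inj: "inj_on (\<lambda>y. ?w y + (if y = x then r u else 0) + r y) ?X"
    and late: "Suc (r u) < a + Suc k \<or> r u \<le> ?w u"
    using ex_ranking_with_transfer[of ?X u x a ?w] xN ux cardX by (auto simp: finite_neighbours)
  \<comment> \<open>The rank of \<open>u\<close> becomes the label of \<open>{u, x}\<close>; the
    star gets the other ranks.\<close>
  define t where "t = r u"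
  have rX: "a \<le> r y" "r y \<le> a + k" if "y \<in> ?X" for y
    using bij_betwE[OF r] that by fastforce+
  have rN: "bij_betw r ?N ({a..<a + Suc k} - {t})"
    using bij_betw_DiffI[OF r, of "{u}" "{t}"] rX[of u] uV by (simp add: t_def less_Suc_eq_le)
  define g where "g = g0({u, x} := t)"
  have "bij_betw g F {1..a - 1}"
    using g0(1) E0(2) by (subst bij_betw_cong[where g = g0]) (auto simp: g_def)
  moreover have "t \<notin> {1..a - 1}" using rX(1)[of u] a2 by (auto simp: t_def)
  ultimately have g: "bij_betw g ?E0 (insert t {1..a - 1})"
    using notIn_Un_bij_betw[of "{u, x}" F g "{1..a - 1}"] E0 by (simp add: g_def)
  have gsum: "vertex_sum ?E0 g y = ?w y + (if y = u \<or> y = x then t else 0)" for y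
  proof -
    have "{e \<in> ?E0. y \<in> e} = (if y = u \<or> y = x then insert {u, x} {e \<in> F. y \<in> e} else {e \<in> F. y \<in> e})"
      using E0 by auto
    moreover have "sum g {e \<in> F. y \<in> e} = ?w y"
      unfolding vertex_sum_def using E0(2) by (intro sum.cong) (auto simp: g_def)
    ultimately show ?thesis using E0(2) finF by (simp add: vertex_sum_def g_def)
  qed
  have "insert t {1..a - 1} \<inter> ({a..<a + Suc k} - {t}) = {}" by auto
  from ex_star_extension[OF g rN this] obtain f
    where f: "bij_betw f E (insert t {1..a - 1} \<union> ({a..<a + Suc k} - {t}))"
    and fN: "\<And>y. y \<in> ?N \<Longrightarrow> vertex_sum E f y = vertex_sum ?E0 g y + r y"
    and fU: "\<And>y. y \<noteq> v \<Longrightarrow> y \<notin> ?N \<Longrightarrow> vertex_sum E f y = vertex_sum ?E0 g y"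
    and fv: "vertex_sum E f v = sum r ?N"
    by blast
  have "insert t {1..a - 1} \<union> ({a..<a + Suc k} - {t}) = {1..card E}"
    using rX[of u] a2 by (auto simp: card_edges[of v] a_def[symmetric] k_def[symmetric] t_def)
  then have bij: "bij_betw f E {1..card E}" using f by simp
  have fX: "vertex_sum E f y = ?w y + (if y = x then r u else 0) + r y" if "y \<in> ?X" for y
    using that fN[of y] fU[of u] uV ux by (auto simp: gsum t_def)
  have injX: "inj_on (vertex_sum E f) ?X"
    using inj by (rule inj_on_cong[THEN iffD1, rotated]) (simp add: fX)

  let ?S = "vertex_sum E f v"
  have "sum r ?X = \<Sum>{a..<a + Suc k}"
    using sum.reindex_bij_betw[OF r, of id] by simp
  then have "?S + t = \<Sum>{a..<a + Suc k}"
    using uV by (simp add: fv t_def finite_neighbours)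
  then have S: "2 * (?S + t) = (k + 1) * (2 * a + k)" using sum_interval_from by metis
  have t: "a \<le> t" "t \<le> a + k" using rX[of u] by (auto simp: t_def)
  \<comment> \<open>For \<open>d = 2\<close>, \<open>abig\<close> says \<open>a < 3\<close>;
    otherwise \<open>3 \<le> d \<le> a\<close>.\<close>
  have small: "a = 2 \<or> a \<ge> 3 \<and> d \<ge> 3"
  proof (cases "d = 2")
    case False
    then show ?thesis using d2 da by auto
  qed (use abig a2 in auto)
  \<comment> \<open>Here \<open>d = 2\<close>, so \<open>?w u \<le> 1 < t\<close>, and
    \<open>late\<close> leaves only that \<open>u\<close> is not ranked last.\<close>
  have top: "t \<le> a + k - 1" if "a = 2"
    using late wu that da d2 k2 by (auto simp: t_def)

  \<comment> \<open>Apart from the common edge \<open>{v, y}\<close>, \<open>y\<close> has at most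
    \<open>k - 1\<close> labels, all below \<open>a\<close>, against \<open>k - 1\<close> labels
    from \<open>a\<close> up at \<open>v\<close>.\<close>
  have other: "vertex_sum E f y < ?S" if y: "y \<in> ?N" "y \<noteq> x" for y
  proof -
    have "degree F y \<le> k - 1" using degN[OF y(1)] degF[of y] by simp
    then have "?w y \<le> (k - 1) * (a - 1)"
      using wle[of y] mult_le_mono1 le_trans by blast
    also have "\<dots> < (k - 1) * a" using k2 a2 by simp
    also have "\<dots> \<le> sum r (?N - {y})"
      using sum_bounded_below[of "?N - {y}" a r] rX y finite_neighbours by (simp add: k_def)
    finally show ?thesis
      using y by (simp add: fX fv sum.remove[OF finite_neighbours y(1)])
  qed
  have "vertex_sum E f u < ?S"
  proof -
    have u_sum: "vertex_sum E f u = ?w u + t" using fX[of u] ux by (simp add: t_def)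
    show ?thesis
    proof (cases "k = 2")
      case True
      then have "a = 2" "d = 2" using small dk d2 by auto
      then show ?thesis using u_sum True S wu top by simp
    next
      case False
      then obtain k' where k': "k = k' + 3" using k2 le_Suc_ex[of 3 k] by auto
      obtain a' where a': "a = a' + 1" using a2 le_Suc_ex[of 1 a] by auto
      \<comment> \<open>With \<open>t \<le> a + k\<close>, twice the gap is at least
        \<open>(k - 2) * (k + 1)\<close>, positive for \<open>k \<ge> 3\<close>.\<close>
      have "?w u \<le> (k - 1) * (a - 1)"
        using wu mult_le_mono1[of "d - 1" "k - 1" "a - 1"] dk by linarith
      then show ?thesis using u_sum S t by (simp add: k' a' algebra_simps)
    qed
  qed
  moreover have "vertex_sum E f x \<noteq> ?S"
  proof -
    define s where "s = r x"
    have x_sum: "vertex_sum E f x = ?w x + t + s" using fX[of x] xN by (simp add: t_def s_def)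
    have s: "s \<noteq> t" "s \<le> a + k"
      using r xN ux rX(2)[of x] by (auto simp: bij_betw_def inj_on_def s_def t_def)
    consider "k = 2" | "k = 3" | "k \<ge> 4" using k2 by linarith
    then show ?thesis
    proof cases
      case 1
      then have "a = 2" and "d = 2" using small dk d2 by auto
      moreover have "t = 2 \<or> t = 3" using 1 \<open>a = 2\<close> t top by auto
      \<comment> \<open>A tie would force \<open>s = 5 > a + k\<close> or
        \<open>s = t = 3\<close>.\<close>
      ultimately have "2 * t + s \<noteq> 9" "?w x = 0" using 1 s wx0 by auto
      then show ?thesis using x_sum S 1 \<open>a = 2\<close> by simp
    next
      case 2
      have "card W \<le> 1" using cardW 2 by simp
      then have "card W = 0 \<or> card W = 1" by auto
      then have "?w x \<le> 1" using wxW by auto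
      \<comment> \<open>A tie means \<open>?w x + 2 * t + s = 4 * a + 6\<close>. For
        \<open>a \<ge> 4\<close> the left side is at most \<open>3 * a + 9\<close>; smaller
        \<open>a\<close> forces \<open>a = d\<close>.\<close>
      moreover have "a = 2 \<or> a = 3 \<Longrightarrow> ?w x = 0" using wx0 small da d2 dk 2 by auto
      ultimately show ?thesis
        using x_sum S 2 small t s top by (cases "a = 2"; cases "a = 3") auto
    next
      case 3
      then obtain k' where k': "k = k' + 4" using le_Suc_ex[of 4 k] by auto
      obtain a' where a': "a = a' + 1" using a2 le_Suc_ex[of 1 a] by auto
      \<comment> \<open>As \<open>s\<close> and \<open>t\<close> differ, one of them is below
        \<open>a + k\<close>. Twice the gap is then at least \<open>k * k - 3 * k - 2\<close>,
        positive from \<open>k = 4\<close> on.\<close>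
      have "2 * t + s < 3 * (a + k)" using t s by (cases "t = a + k") auto
      then show ?thesis using x_sum S wx by (simp add: k' a' algebra_simps)
    qed
  qed
  ultimately have "vertex_sum E f y \<noteq> ?S" if "y \<in> ?X" for y
    using other[of y] that by fastforce
  then have "?S \<notin> vertex_sum E f ` ?X" by (simp only: image_iff) metis
  moreover have "V = insert v ?X" using u v neighbours_subset[of v] by blast
  ultimately have "inj_on (vertex_sum E f) V"
    using injX inj_on_insert[of "vertex_sum E f" v ?X] by blast
  then show ?thesis using bij by (auto simp: antimagic_def antimagic_labeling_def)
qed

end

section \<open>Choice of \<open>v\<close> and its possible non-neighbour\<close>

theorem theorem1p3:
  fixes V :: "'a set" and E :: "'a set set"
  assumes "simple_graph V E"
    and "card V \<ge> 4"
    and "max_degree V E \<ge> card V - 2"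
  shows "antimagic V E"
proof -
  have fin: "finite V" "V \<noteq> {}" using assms(1,2) by (auto simp: simple_graph_def)
  then have "max_degree V E \<in> degree E ` V" by (simp add: max_degree_def)
  then obtain v where v: "v \<in> V" "degree E v = max_degree V E" by auto
  let ?N = "neighbours E v" and ?E0 = "avoiding E v"
  have cardN: "card ?N = max_degree V E"
    using v degree_eq_card_neighbours[OF assms(1)] by simp
  have deg: "degree E y \<le> card ?N" if "y \<in> V" for y
    using that fin by (simp add: cardN max_degree_def)
  have k: "2 \<le> card ?N" using cardN assms(2,3) by simp
  have NV: "?N \<subseteq> V - {v}"
    using neighbours_subset[OF assms(1)] neighbour_ne[OF assms(1)] by blast
  have "card (V - {v} - ?N) = card V - 1 - card ?N"
    using NV fin v by (simp add: card_Diff_subset finite_subset)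
  then have "card (V - {v} - ?N) \<le> 1" using cardN assms(3) by simp
  then have "card (V - {v} - ?N) = 0 \<or> card (V - {v} - ?N) = 1" by auto
  then consider "V - {v} - ?N = {}" | u where "V - {v} - ?N = {u}"
    using fin by (auto simp: card_1_singleton_iff)
  then show ?thesis
  proof cases
    case 1
    \<comment> \<open>Every vertex but \<open>v\<close> is a neighbour, so the small labels may be
      placed arbitrarily.\<close>
    obtain g where "bij_betw g ?E0 {1..card ?E0}"
      using ex_bij_betw_initial[OF finite_avoiding[OF assms(1)]] by blast
    then show ?thesis
      using antimagic_star_on_top[OF assms(1) v(1) k deg] 1 by blast
  next
    case (2 u)
    show ?thesis
    proof (cases "\<Sum>{1..degree E u} \<le> card ?E0")
      case True
      let ?W = "{e \<in> ?E0. u \<in> e}"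
      obtain g where g: "bij_betw g ?E0 {1..card ?E0}" "bij_betw g ?W {1..card ?W}"
        using ex_bij_betw_initial[OF finite_avoiding[OF assms(1)], of ?W] by auto
      have "u \<noteq> v" "u \<notin> ?N" using 2 by auto
      then have "card ?W = degree E u"
        using degree_non_neighbour[OF assms(1)] by (simp add: degree_def)
      then have "vertex_sum ?E0 g u \<le> card ?E0"
        using sum.reindex_bij_betw[OF g(2), of id] True by (simp add: vertex_sum_def)
      then show ?thesis
        using antimagic_star_on_top[OF assms(1) v(1) k deg g(1)] 2 by blast
    next
      case False
      then show ?thesis
        using antimagic_star_and_edge_on_top[OF assms(1) v(1) k deg 2] by simp
    qed
  qed
qed

end
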